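(* For any $n\in\mathbb{N}$ (with $n\ge 1$) and any norm $\eta:\mathbb{R}^n\to\mathbb{R}$, there exist an $n$-dimensional combinatorial cube $C_n\subset\mathbb{R}^n$ and $\mathbf{c}\in\mathbb{R}^n$ for which the pivot rule given by \[\mathbf{v}^{i+1} = \operatorname*{arg\,max}_{\mathbf{u}\in N_{\mathbf{c}}(\mathbf{v}^i)} \frac{\mathbf{c}^{\intercal}(\mathbf{u}-\mathbf{v}^i)}{\eta(\mathbf{u}-\mathbf{v}^i)},\] where $N_{\mathbf{c}}(\mathbf{v}^i)$ is the set of $\mathbf{c}$-improving neighbors of $\mathbf{v}^i$, follows (from a suitable initial vertex) a path through all vertices of $C_n$ to maximize $\mathbf{c}^{\intercal}\mathbf{x}$ over $C_n$.
   Context: An $n$-dimensional combinatorial cube is an $n$-dimensional polytope whose face lattice is isomorphic to that of $[0,1]^n$. For a vertex $\mathbf{v}$ of a polytope, a $\mathbf{c}$-improving neighbor is a vertex $\mathbf{u}$ joined to $\mathbf{v}$ by an edge of the polytope with $\mathbf{c}^{\intercal}\mathbf{u}>\mathbf{c}^{\intercal}\mathbf{v}$. Starting from an initial vertex $\mathbf{v}^0$, the pivot rule moves at each step from $\mathbf{v}^i$ to the neighbor $\mathbf{v}^{i+1}$ attaining the maximum, and stops when $N_{\mathbf{c}}(\mathbf{v}^i)=\emptyset$, i.e. at a maximizer of $\mathbf{c}^{\intercal}\mathbf{x}$. Lower bounds for a pivot rule are understood as allowing a choice of initial vertex; since $\mathbf{c}^{\intercal}\mathbf{x}$ increases along the path,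 a path through all vertices necessarily starts at the $\mathbf{c}$-minimal vertex. *)

theory Defs
  imports "HOL-Analysis.Analysis"
begin

definition is_norm :: "('a::real_vector \<Rightarrow> real) \<Rightarrow> bool" where
  "is_norm \<eta> \<longleftrightarrow>
     (\<forall>x. 0 \<le> \<eta> x) \<and>
     (\<forall>x. \<eta> x = 0 \<longleftrightarrow> x = 0) \<and>
     (\<forall>a x. \<eta> (a *\<^sub>R x) = \<bar>a\<bar> * \<eta> x) \<and>
     (\<forall>x y. \<eta> (x + y) \<le> \<eta> x + \<eta> y)"

text \<open>The face lattice of a polytope is ordered by inclusion and contains the empty face and the
  polytope itself, both of which satisfy \<^const>\<open>face_of\<close>.\<close>

definition faces :: "'a::real_vector set \<Rightarrow> 'a set set" where
  "faces P = {F. F face_of P}"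

definition face_lattice_isomorphic :: "'a::real_vector set \<Rightarrow> 'b::real_vector set \<Rightarrow> bool" where
  "face_lattice_isomorphic P Q \<longleftrightarrow>
     (\<exists>\<phi>. bij_betw \<phi> (faces P) (faces Q) \<and>
          (\<forall>F\<in>faces P. \<forall>G\<in>faces P. F \<subseteq> G \<longleftrightarrow> \<phi> F \<subseteq> \<phi> G))"

text \<open>Here \<open>n = CARD('n)\<close>; the set \<open>cbox 0 1\<close> is the cube \<open>[0,1]^n\<close>, since \<open>1\<close> denotes the all-ones
  vector in \<open>real ^ 'n\<close>.\<close>

definition combinatorial_cube :: "(real ^ 'n) set \<Rightarrow> bool" where
  "combinatorial_cube C \<longleftrightarrow>
     polytope C \<and> aff_dim C = int CARD('n) \<and>
     face_lattice_isomorphic C (cbox 0 1 :: (real ^ 'n) set)"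

definition vertices :: "'a::real_vector set \<Rightarrow> 'a set" where
  "vertices P = {v. v extreme_point_of P}"

definition improving_neighbors ::
    "'a::euclidean_space set \<Rightarrow> 'a \<Rightarrow> 'a \<Rightarrow> 'a set" where
  "improving_neighbors P c v =
     {u \<in> vertices P. closed_segment v u edge_of P \<and> c \<bullet> u > c \<bullet> v}"

definition argmax_set :: "('a \<Rightarrow> real) \<Rightarrow> 'a set \<Rightarrow> 'a set" where
  "argmax_set f A = {u. is_arg_max f (\<lambda>x. x \<in> A) u}"

text \<open>The finite sequence \<open>v 0, \<dots>, v N\<close> is the complete run of the pivot rule from the vertex \<open>v 0\<close>.
  Each step requires the maximizer to be unique, so the run does not depend on any tie-breaking.
  Values of \<open>v\<close> beyond \<open>N\<close> are irrelevant.\<close>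

definition pivot_run ::
    "('a::euclidean_space \<Rightarrow> real) \<Rightarrow> 'a set \<Rightarrow> 'a \<Rightarrow> (nat \<Rightarrow> 'a) \<Rightarrow> nat \<Rightarrow> bool" where
  "pivot_run \<eta> P c v N \<longleftrightarrow>
     v 0 \<in> vertices P \<and>
     (\<forall>i<N. argmax_set (\<lambda>u. (c \<bullet> (u - v i)) / \<eta> (u - v i)) (improving_neighbors P c (v i))
              = {v (Suc i)}) \<and>
     improving_neighbors P c (v N) = {}"

end

theory Submission
  imports Defs
begin

text \<open>Consider the Klee-Minty type cube \<open>0 \<le> x\<^sub>k \<le> 3\<^sup>k - 2 * (x\<^sub>0 + \<dots> + x\<^sub>k\<^sub>-\<^sub>1)\<close> with objective
  \<open>y = \<Sum>k. x\<^sub>k\<close> and auxiliary functional \<open>z = \<Sum>k. 3\<^sup>k * x\<^sub>k\<close>. At every vertex the slopes \<open>\<Delta>z / \<Delta>y\<close> of the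
  improving edges increase with the flipped coordinate, so choosing the smallest slope means
  flipping the least improving coordinate, and this traces the binary reflected Gray code through
  all vertices. Stretching the cube by \<open>x \<mapsto> z(x) * q + d * x\<close> with a small \<open>d > 0\<close> makes any given
  norm of an edge almost proportional to \<open>\<bar>\<Delta>z\<bar>\<close>, so that the pivot rule selects the smallest slope.
  The faces of the stretched cube match those of \<open>[0,1]\<^sup>n\<close> because the map
  \<open>\<theta> \<mapsto> x\<close>, \<open>x\<^sub>k = \<theta>\<^sub>k * (3\<^sup>k - 2 * (x\<^sub>0 + \<dots> + x\<^sub>k\<^sub>-\<^sub>1))\<close>, preserves sets of active constraints.\<close>

subsection \<open>Faces of a polyhedron and active constraints\<close>

text \<open>With weights in (0,1), a sum of two nonnegative terms vanishes only if both terms do, so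
  an inequality tight inside a segment is tight at its ends.\<close>

lemma active_set_face_of:
  fixes g :: "'i \<Rightarrow> 'a::real_vector \<Rightarrow> real"
  assumes aff: "\<And>i x y t. i \<in> I \<Longrightarrow> g i ((1 - t) *\<^sub>R x + t *\<^sub>R y) = (1 - t) * g i x + t * g i y"
    and "J \<subseteq> I"
  shows "{x. (\<forall>i\<in>I. 0 \<le> g i x) \<and> (\<forall>i\<in>J. g i x = 0)} face_of {x. \<forall>i\<in>I. 0 \<le> g i x}"
  unfolding face_of_def
proof (intro conjI ballI impI)
  show "convex {x. (\<forall>i\<in>I. 0 \<le> g i x) \<and> (\<forall>i\<in>J. g i x = 0)}"
    unfolding convex_alt using aff assms(2) by (auto simp: subset_iff)
next
  fix a b x
  assume ab: "a \<in> {x. \<forall>i\<in>I. 0 \<le> g i x}" "b \<in> {x. \<forall>i\<in>I. 0 \<le> g i x}"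
    and x: "x \<in> {x. (\<forall>i\<in>I. 0 \<le> g i x) \<and> (\<forall>i\<in>J. g i x = 0)}" "x \<in> open_segment a b"
  then obtain t where t: "0 < t" "t < 1" "x = (1 - t) *\<^sub>R a + t *\<^sub>R b"
    by (auto simp: in_segment)
  have "g i a = 0 \<and> g i b = 0" if "i \<in> J" for i
  proof -
    have "i \<in> I" using that assms(2) by auto
    then have "(1 - t) * g i a + t * g i b = 0" "0 \<le> (1 - t) * g i a" "0 \<le> t * g i b"
      using x ab t that aff[of i t a b] by auto
    then have "(1 - t) * g i a = 0" "t * g i b = 0" by linarith+
    then show ?thesis using t by auto
  qed
  then show "a \<in> {x. (\<forall>i\<in>I. 0 \<le> g i x) \<and> (\<forall>i\<in>J. g i x = 0)}"
    "b \<in> {x. (\<forall>i\<in>I. 0 \<le> g i x) \<and> (\<forall>i\<in>J. g i x = 0)}"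
    using ab by auto
qed auto

text \<open>Take for \<open>J\<close> the inequalities tight on all of \<open>F\<close>. A point
  \<open>x\<close> of \<open>F\<close> at which the others are strict lets the segment from any
  \<open>y\<close> satisfying the equations be prolonged slightly beyond \<open>x\<close>; the face
  property then puts \<open>y\<close> into \<open>F\<close>.\<close>

lemma face_of_eq_active_set:
  fixes g :: "'i \<Rightarrow> 'a::real_vector \<Rightarrow> real"
  assumes aff: "\<And>i x y t. i \<in> I \<Longrightarrow> g i ((1 - t) *\<^sub>R x + t *\<^sub>R y) = (1 - t) * g i x + t * g i y"
    and "finite I" and F: "F face_of {x. \<forall>i\<in>I. 0 \<le> g i x}" and "F \<noteq> {}"
  obtains J where "J \<subseteq> I" "F = {x. (\<forall>i\<in>I. 0 \<le> g i x) \<and> (\<forall>i\<in>J. g i x = 0)}"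
proof -
  define J where "J = {i\<in>I. \<forall>x\<in>F. g i x = 0}"
  have sub: "F \<subseteq> {x. \<forall>i\<in>I. 0 \<le> g i x}" and cvx: "convex F"
    using face_of_imp_subset[OF F] face_of_imp_convex[OF F] .
  \<comment> \<open>Taking midpoints collects strictness: where one point is strict and the other
    nonnegative, the midpoint is strict.\<close>
  have "\<exists>x\<in>F. \<forall>i\<in>K. 0 < g i x" if "finite K" "K \<subseteq> I - J" for K
    using that
  proof (induction K rule: finite_induct)
    case empty
    then show ?case using \<open>F \<noteq> {}\<close> by auto
  next
    case (insert i K)
    then obtain x where x: "x \<in> F" "\<forall>j\<in>K. 0 < g j x" by auto
    obtain y where y: "y \<in> F" "g i y \<noteq> 0" using insert.prems unfolding J_def by auto
    have K: "\<And>j. j \<in> insert i K \<Longrightarrow> j \<in> I" using insert.prems by auto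
    have nonneg: "0 \<le> g j x" "0 \<le> g j y" if "j \<in> insert i K" for j
      using sub x y K[OF that] by auto
    have "(1 - 1/2) *\<^sub>R x + (1/2) *\<^sub>R y \<in> F"
      using cvx x y by (intro convexD_alt) auto
    moreover have "0 < g j ((1 - 1/2) *\<^sub>R x + (1/2) *\<^sub>R y)" if "j \<in> insert i K" for j
    proof -
      have "g j ((1 - 1/2) *\<^sub>R x + (1/2) *\<^sub>R y) = (1 - 1/2) * g j x + (1/2) * g j y"
        using aff K that by blast
      moreover have "0 < g j x \<or> 0 < g j y"
        using that x y nonneg[OF that] by force
      ultimately show ?thesis using nonneg[OF that] by auto
    qed
    ultimately show ?case by blast
  qed
  from this[of "I - J"] obtain x where x: "x \<in> F" "\<And>i. i \<in> I - J \<Longrightarrow> 0 < g i x"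
    using \<open>finite I\<close> by auto
  have "y \<in> F" if y: "\<forall>i\<in>I. 0 \<le> g i y" "\<forall>i\<in>J. g i y = 0" for y
  proof (cases "x = y")
    case False
    \<comment> \<open>The prolonged point \<open>x + t (x - y)\<close> is the affine combination
      with parameter \<open>- t\<close>, to which \<open>aff\<close> applies since it covers all
      real parameters.\<close>
    have "\<forall>\<^sub>F t in at_right 0. \<forall>i\<in>I-J. 0 < (1 - (- t)) * g i x + (- t) * g i y"
    proof (intro eventually_ball_finite ballI)
      fix i assume "i \<in> I - J"
      have "((\<lambda>t. (1 - (- t)) * g i x + (- t) * g i y) \<longlongrightarrow> (1 - (- 0)) * g i x + (- 0) * g i y) (at_right 0)"
        by (intro tendsto_intros)
      then show "\<forall>\<^sub>F t in at_right 0. 0 < (1 - (- t)) * g i x + (- t) * g i y"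
        by (rule order_tendstoD) (use x \<open>i \<in> I - J\<close> in auto)
    qed (use \<open>finite I\<close> in auto)
    then have "\<forall>\<^sub>F t in at_right 0. (0::real) < t \<and> (\<forall>i\<in>I-J. 0 < (1 - (- t)) * g i x + (- t) * g i y)"
      using eventually_at_right_less by (rule eventually_conj[rotated])
    then obtain t where t: "0 < t" "\<forall>i\<in>I-J. 0 < (1 - (- t)) * g i x + (- t) * g i y"
      using eventually_happens'[of "at_right (0::real)"] by (metis (no_types, lifting) trivial_limit_at_right_real)
    define w where "w = (1 - (- t)) *\<^sub>R x + (- t) *\<^sub>R y"
    have gw: "g i w = (1 - (- t)) * g i x + (- t) * g i y" if "i \<in> I" for i
      unfolding w_def by (rule aff[OF that])
    have "0 \<le> g i w" if "i \<in> I" for i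
    proof (cases "i \<in> J")
      case True
      then have "g i x = 0" using x(1) by (auto simp: J_def)
      then show ?thesis using True gw[OF that] y by auto
    next
      case False
      then show ?thesis using t(2) gw[OF that] that by (metis DiffI less_imp_le)
    qed
    moreover have "x \<in> open_segment y w"
    proof -
      have "(1 - 1/(1+t)) *\<^sub>R y + (1/(1+t)) *\<^sub>R w
          = (1/(1+t)) *\<^sub>R (t *\<^sub>R y + w)"
        using t(1) by (simp add: scaleR_add_right field_simps)
      also have "\<dots> = x"
        using t(1) unfolding w_def by simp
      finally have "x = (1 - 1/(1+t)) *\<^sub>R y + (1/(1+t)) *\<^sub>R w" by simp
      moreover have "y \<noteq> w"
      proof
        assume "y = w"
        then have "(1 + t) *\<^sub>R (x - y) = 0" unfolding w_def by (simp add: algebra_simps)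
        then show False using t(1) False by simp
      qed
      ultimately show ?thesis using t(1) by (auto simp: in_segment intro!: exI[of _ "1/(1+t)"])
    qed
    ultimately show ?thesis
      using F x(1) y(1) unfolding face_of_def by blast
  qed (use x in auto)
  moreover have "\<forall>i\<in>J. g i y = 0" if "y \<in> F" for y
    using that by (simp add: J_def)
  ultimately have "F = {x. (\<forall>i\<in>I. 0 \<le> g i x) \<and> (\<forall>i\<in>J. g i x = 0)}"
    using sub by blast
  moreover have "J \<subseteq> I" by (simp add: J_def)
  ultimately show ?thesis using that by blast
qed

lemma faces_eq_active_sets:
  fixes g :: "'i \<Rightarrow> 'a::real_vector \<Rightarrow> real"
  assumes aff: "\<And>i x y t. i \<in> I \<Longrightarrow> g i ((1 - t) *\<^sub>R x + t *\<^sub>R y) = (1 - t) * g i x + t * g i y"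
    and "finite I"
  shows "faces {x. \<forall>i\<in>I. 0 \<le> g i x}
    = insert {} ((\<lambda>J. {x. (\<forall>i\<in>I. 0 \<le> g i x) \<and> (\<forall>i\<in>J. g i x = 0)}) ` Pow I)"
proof (rule set_eqI)
  fix F
  have "F face_of {x. \<forall>i\<in>I. 0 \<le> g i x} \<longleftrightarrow> F = {} \<or>
     (\<exists>J\<subseteq>I. F = {x. (\<forall>i\<in>I. 0 \<le> g i x) \<and> (\<forall>i\<in>J. g i x = 0)})"
  proof
    assume F: "F face_of {x. \<forall>i\<in>I. 0 \<le> g i x}"
    show "F = {} \<or> (\<exists>J\<subseteq>I. F = {x. (\<forall>i\<in>I. 0 \<le> g i x) \<and> (\<forall>i\<in>J. g i x = 0)})"
    proof (cases "F = {}")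
      case False
      with aff \<open>finite I\<close> F obtain J
        where "J \<subseteq> I" "F = {x. (\<forall>i\<in>I. 0 \<le> g i x) \<and> (\<forall>i\<in>J. g i x = 0)}"
        by (rule face_of_eq_active_set[of I g F])
      then show ?thesis by (intro disjI2 exI conjI)
    qed simp
  next
    assume "F = {} \<or> (\<exists>J\<subseteq>I. F = {x. (\<forall>i\<in>I. 0 \<le> g i x) \<and> (\<forall>i\<in>J. g i x = 0)})"
    then show "F face_of {x. \<forall>i\<in>I. 0 \<le> g i x}"
    proof (elim disjE exE conjE)
      fix J assume "J \<subseteq> I" and F: "F = {x. (\<forall>i\<in>I. 0 \<le> g i x) \<and> (\<forall>i\<in>J. g i x = 0)}"
      from aff \<open>J \<subseteq> I\<close> show ?thesis unfolding F by (rule active_set_face_of[of I g J])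
    qed simp
  qed
  then show "F \<in> faces {x. \<forall>i\<in>I. 0 \<le> g i x} \<longleftrightarrow>
    F \<in> insert {} ((\<lambda>J. {x. (\<forall>i\<in>I. 0 \<le> g i x) \<and> (\<forall>i\<in>J. g i x = 0)}) ` Pow I)"
    unfolding faces_def insert_iff image_iff Pow_iff mem_Collect_eq Bex_def .
qed

text \<open>Nonempty faces are given by active constraints alone, so a possibly nonlinear bijection
  that preserves activity carries the face of \<open>J\<close> to the face of \<open>J\<close>.
  Taking images is then the lattice isomorphism.\<close>

lemma face_lattice_isomorphic_active_set:
  fixes g :: "'i \<Rightarrow> 'a::real_vector \<Rightarrow> real" and h :: "'i \<Rightarrow> 'b::real_vector \<Rightarrow> real"
  assumes g: "\<And>i x y t. i \<in> I \<Longrightarrow> g i ((1 - t) *\<^sub>R x + t *\<^sub>R y) = (1 - t) * g i x + t * g i y"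
    and h: "\<And>i x y t. i \<in> I \<Longrightarrow> h i ((1 - t) *\<^sub>R x + t *\<^sub>R y) = (1 - t) * h i x + t * h i y"
    and "finite I"
    and bij: "bij_betw \<psi> {x. \<forall>i\<in>I. 0 \<le> g i x} {x. \<forall>i\<in>I. 0 \<le> h i x}"
    and active: "\<And>i x. i \<in> I \<Longrightarrow> \<forall>i\<in>I. 0 \<le> g i x \<Longrightarrow> h i (\<psi> x) = 0 \<longleftrightarrow> g i x = 0"
  shows "face_lattice_isomorphic {x. \<forall>i\<in>I. 0 \<le> g i x} {x. \<forall>i\<in>I. 0 \<le> h i x}"
proof -
  define P where "P = {x. \<forall>i\<in>I. 0 \<le> g i x}"
  define Q where "Q = {x. \<forall>i\<in>I. 0 \<le> h i x}"
  define A where "A = (\<lambda>J. {x\<in>P. \<forall>i\<in>J. g i x = 0})"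
  define B where "B = (\<lambda>J. {x\<in>Q. \<forall>i\<in>J. h i x = 0})"
  have facesP: "faces P = insert {} (A ` Pow I)"
    using faces_eq_active_sets[of I g, OF g \<open>finite I\<close>] by (simp add: P_def A_def)
  have facesQ: "faces Q = insert {} (B ` Pow I)"
    using faces_eq_active_sets[of I h, OF h \<open>finite I\<close>] by (simp add: Q_def B_def)
  have inj: "inj_on \<psi> P" and im: "\<psi> ` P = Q"
    using bij unfolding bij_betw_def P_def Q_def by auto
  have sub: "F \<subseteq> P" if "F \<in> faces P" for F
    using that unfolding facesP A_def by auto
  have "\<psi> ` A J = B J" if "J \<subseteq> I" for J
  proof -
    have "(\<forall>i\<in>J. g i x = 0) \<longleftrightarrow> (\<forall>i\<in>J. h i (\<psi> x) = 0)" if "x \<in> P" for x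
      using that active[OF subsetD[OF \<open>J \<subseteq> I\<close>], of _ x] by (simp add: P_def)
    then have "A J = {x\<in>P. \<forall>i\<in>J. h i (\<psi> x) = 0}"
      unfolding A_def by blast
    then show ?thesis unfolding B_def im[symmetric] by blast
  qed
  then have "(\<lambda>J. \<psi> ` A J) ` Pow I = B ` Pow I"
    by (intro image_cong) auto
  then have "(`) \<psi> ` faces P = faces Q"
    unfolding facesP facesQ by (simp add: image_image)
  moreover have "inj_on ((`) \<psi>) (faces P)"
    using inj sub by (intro inj_onI) (meson inj_on_image_eq_iff)
  moreover have "\<forall>F\<in>faces P. \<forall>G\<in>faces P. F \<subseteq> G \<longleftrightarrow> \<psi> ` F \<subseteq> \<psi> ` G"
    using inj_on_image_subset_iff[OF inj sub sub] by simp
  ultimately show ?thesis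
    unfolding face_lattice_isomorphic_def bij_betw_def P_def[symmetric] Q_def[symmetric]
    by (intro exI[of _ "(`) \<psi>"]) simp
qed

subsection \<open>Recursive coordinates on the deformed cube\<close>

text \<open>Here \<theta> gives relative positions: coordinate \<open>k\<close> divides its
  admissible interval, of length \<open>3 ^ k - 2 * psum \<theta> k\<close>, in the ratio
  \<open>\<theta> k\<close>. Recursing on prefix sums keeps the definition primitive
  recursive.\<close>

primrec psum :: "(nat \<Rightarrow> real) \<Rightarrow> nat \<Rightarrow> real" where
  "psum \<theta> 0 = 0"
| "psum \<theta> (Suc k) = psum \<theta> k + \<theta> k * (3 ^ k - 2 * psum \<theta> k)"

definition coord :: "(nat \<Rightarrow> real) \<Rightarrow> nat \<Rightarrow> real" where
  "coord \<theta> k = \<theta> k * (3 ^ k - 2 * psum \<theta> k)"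

lemma sum_coord: "(\<Sum>k<n. coord \<theta> k) = psum \<theta> n"
  by (induction n) (auto simp: coord_def)

lemma psum_cong: "(\<And>k. k < n \<Longrightarrow> \<theta> k = \<theta>' k) \<Longrightarrow> psum \<theta> n = psum \<theta>' n"
  by (induction n) auto

lemma coord_cong: "(\<And>j. j \<le> k \<Longrightarrow> \<theta> j = \<theta>' j) \<Longrightarrow> coord \<theta> k = coord \<theta>' k"
  unfolding coord_def using psum_cong[of k \<theta> \<theta>'] by auto

text \<open>A prefix sum \<open>s\<close> grows by at most \<open>3 ^ n - 2 * s\<close>, hence to at
  most \<open>3 ^ n - s\<close>, whose double is below \<open>3 ^ Suc n\<close>. The strict bound
  keeps every later interval nondegenerate.\<close>

lemma psum_bounds:
  assumes "\<And>k. k < n \<Longrightarrow> 0 \<le> \<theta> k \<and> \<theta> k \<le> 1"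
  shows "0 \<le> psum \<theta> n \<and> 2 * psum \<theta> n < 3 ^ n"
  using assms
proof (induction n)
  case (Suc n)
  have IH: "0 \<le> psum \<theta> n" "2 * psum \<theta> n < 3 ^ n" using Suc by auto
  have "0 \<le> \<theta> n" "\<theta> n \<le> 1" using Suc.prems by auto
  moreover define w where "w = \<theta> n * (3 ^ n - 2 * psum \<theta> n)"
  ultimately have "0 \<le> w" "w \<le> 1 * (3 ^ n - 2 * psum \<theta> n)"
    using IH by (auto simp: w_def simp del: mult_1 intro!: mult_right_mono)
  moreover have "psum \<theta> (Suc n) = psum \<theta> n + w" by (simp add: w_def)
  ultimately show ?case using IH by simp
qed auto

text \<open>The sharp maximum of the objective, attained at the bit set \<open>{m}\<close> by
  \<open>psum_bits_last\<close>.\<close>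

lemma psum_le:
  assumes "\<And>k. k < Suc m \<Longrightarrow> 0 \<le> \<theta> k \<and> \<theta> k \<le> 1"
  shows "psum \<theta> (Suc m) \<le> 3 ^ m"
proof -
  have p: "0 \<le> psum \<theta> m" "2 * psum \<theta> m < 3 ^ m" using psum_bounds[of m \<theta>] assms by auto
  have "\<theta> m * (3 ^ m - 2 * psum \<theta> m) \<le> 3 ^ m - 2 * psum \<theta> m"
    using assms[of m] p by (intro mult_left_le_one_le) auto
  then show ?thesis using p unfolding psum.simps by linarith
qed

subsection \<open>Slopes along the edges\<close>

definition flip :: "'a \<Rightarrow> 'a set \<Rightarrow> 'a set" where
  "flip k b = (if k \<in> b then b - {k} else insert k b)"

lemma mem_flip: "j \<in> flip k b \<longleftrightarrow> (j \<in> b) \<noteq> (j = k)"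
  by (auto simp: flip_def)

text \<open>\<open>up n b k\<close> says that flipping bit \<open>k\<close> of the vertex \<open>b\<close> increases the objective \<open>psum\<close>, and
  \<open>slope n b k\<close> is the ratio of the change of \<open>\<Sum>j<n. 3 ^ j * x\<^sub>j\<close> to that of the objective along this edge.
  Raising \<open>n\<close> to \<open>n + 1\<close> maps slopes at vertices on the new top facet by \<open>s \<mapsto> 2 * 3 ^ n - s\<close>, which
  reverses both the objective and the order of the slopes.\<close>

definition up :: "nat \<Rightarrow> nat set \<Rightarrow> nat \<Rightarrow> bool" where
  "up n b k \<longleftrightarrow> even (card (b \<inter> {k..<n}))"

lemma up_Suc: "k \<le> n \<Longrightarrow> up (Suc n) b k \<longleftrightarrow> up n b k = (n \<notin> b)"
  by (auto simp: up_def atLeastLessThanSuc)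

lemma up_Suc_left: "k < n \<Longrightarrow> up n b k \<longleftrightarrow> up n b (Suc k) = (k \<notin> b)"
proof -
  assume "k < n"
  then have "{k..<n} = insert k {Suc k..<n}" by auto
  then show ?thesis by (auto simp: up_def)
qed

lemma up_refl: "up n b n"
  by (simp add: up_def)

primrec slope :: "nat \<Rightarrow> nat set \<Rightarrow> nat \<Rightarrow> real" where
  "slope 0 b k = 0"
| "slope (Suc n) b k = (if k = n then 3 ^ n else if n \<in> b then 2 * 3 ^ n - slope n b k else slope n b k)"

text \<open>The reflection \<open>s \<mapsto> 2 * 3 ^ n - s\<close> sends the interval from 0 to
  \<open>3 ^ n\<close> into that from \<open>3 ^ n\<close> to \<open>2 * 3 ^ n\<close>, still below
  \<open>3 ^ Suc n\<close>.\<close>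

lemma slope_bounds: "k < n \<Longrightarrow> 0 < slope n b k \<and> slope n b k < 3 ^ n"
proof (induction n)
  case (Suc n)
  then show ?case using one_le_power[of "3::real" n]
    by (cases "k = n") (auto simp: algebra_simps)
qed auto

text \<open>Both directions are proved together because the reflection at a set top bit exchanges
  them. A new top bit has slope \<open>3 ^ n\<close>, which separates unreflected slopes from
  reflected ones.\<close>

lemma slope_order:
  "k < l \<Longrightarrow> l < n \<Longrightarrow> (up n b k \<and> up n b l \<longrightarrow> slope n b k < slope n b l)
    \<and> (\<not> up n b k \<and> \<not> up n b l \<longrightarrow> slope n b l < slope n b k)"
proof (induction n)
  case (Suc n)
  show ?case
  proof (cases "l = n")
    case True
    then show ?thesis
      using Suc.prems slope_bounds[of k n b] by (auto simp: up_Suc up_refl)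
  next
    case False
    then show ?thesis using Suc by (auto simp: up_Suc)
  qed
qed auto

abbreviation bits :: "nat set \<Rightarrow> nat \<Rightarrow> real" where
  "bits b k \<equiv> of_bool (k \<in> b)"

lemma psum_bits_last: "psum (bits {m}) (Suc m) = 3 ^ m"
proof -
  have "psum (bits {m}) m = psum (\<lambda>_. 0) m" by (rule psum_cong) simp
  moreover have "psum (\<lambda>_. 0) m = 0" by (induction m) auto
  ultimately show ?thesis by simp
qed

text \<open>If bit \<open>n\<close> is set, the last coordinate \<open>3 ^ n - 2 * p\<close> turns
  the objective \<open>p\<close> into \<open>3 ^ n - p\<close>: the objective change is negated, and
  the weighted sum gains \<open>- 2 * 3 ^ n\<close> times the old change. This is the recursion of
  \<open>up\<close> and \<open>slope\<close>.\<close>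

lemma psum_flip:
  assumes "k < n"
  shows "0 < (if up n b k then 1 else -1) * (psum (bits (flip k b)) n - psum (bits b) n)"
    and "(\<Sum>j<n. 3 ^ j * coord (bits (flip k b)) j) - (\<Sum>j<n. 3 ^ j * coord (bits b) j)
        = slope n b k * (psum (bits (flip k b)) n - psum (bits b) n)"
  using assms
proof (induction n)
  case (Suc n)
  let ?b = "flip k b"
  {
    case 1
    show ?case
    proof (cases "k = n")
      case True
      have "psum (bits ?b) n = psum (bits b) n"
        using True by (intro psum_cong) (auto simp: mem_flip)
      moreover have "2 * psum (bits b) n < 3 ^ n" using psum_bounds[of n "bits b"] by auto
      ultimately show ?thesis using True by (auto simp: up_Suc up_refl mem_flip)
    next
      case False
      then have "k < n" using 1 by simp
      then show ?thesis using Suc.IH(1) False by (auto simp: up_Suc mem_flip split: if_splits)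
    qed
  next
    case 2
    show ?case
    proof (cases "k = n")
      case True
      have "psum (bits ?b) n = psum (bits b) n"
        using True by (intro psum_cong) (auto simp: mem_flip)
      moreover have "(\<Sum>j<n. 3 ^ j * coord (bits ?b) j) = (\<Sum>j<n. 3 ^ j * coord (bits b) j)"
        using True by (intro sum.cong arg_cong2[where f="(*)"] coord_cong refl) (auto simp: mem_flip)
      ultimately show ?thesis using True by (auto simp: mem_flip coord_def algebra_simps)
    next
      case False
      then have "k < n" using 2 by simp
      then show ?thesis using Suc.IH(2) False by (auto simp: coord_def mem_flip algebra_simps)
    qed
  }
qed auto

subsection \<open>The Gray code\<close>

text \<open>The set of one bits of \<open>i\<close> XOR \<open>i div 2\<close>.\<close>

definition gray :: "nat \<Rightarrow> nat set" where
  "gray i = {k. bit i k \<noteq> bit i (Suc k)}"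

lemma not_bit_ge: "(i::nat) < 2 ^ n \<Longrightarrow> n \<le> k \<Longrightarrow> \<not> bit i k"
proof -
  assume "i < 2 ^ n" "n \<le> k"
  then have "i < 2 ^ k" by (meson less_le_trans one_le_numeral power_increasing)
  then show ?thesis by (simp add: bit_iff_odd)
qed

lemma gray_subset: "i < 2 ^ n \<Longrightarrow> gray i \<subseteq> {..<n}"
  using not_bit_ge[of i n] le_SucI[of n] by (auto simp: gray_def simp flip: not_le)

text \<open>So passing from \<open>gray i\<close> to \<open>gray (i + 1)\<close>, a binary increment of \<open>i\<close>, flips the least
  improving bit.\<close>

lemma up_gray:
  assumes "i < 2 ^ n" "k \<le> n"
  shows "up n (gray i) k \<longleftrightarrow> \<not> bit i k"
  using assms(2)
\<comment> \<open>Downward induction telescopes: bit \<open>k\<close> enters the parity count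
  exactly when bits \<open>k\<close> and \<open>k + 1\<close> of \<open>i\<close> differ, and bit
  \<open>n\<close> is zero.\<close>
proof (induction k rule: inc_induct)
  case base
  then show ?case using not_bit_ge[OF assms(1), of n] by (simp add: up_refl)
next
  case (step k)
  then show ?case using up_Suc_left[of k n "gray i"] by (auto simp: gray_def)
qed

text \<open>By \<open>up_gray\<close> the bits of \<open>i\<close> can be read off as suffix
  parities of \<open>gray i\<close>.\<close>

lemma gray_inj: "inj_on gray {..<2 ^ n}"
proof (rule inj_onI)
  fix i j :: nat assume ij: "i \<in> {..<2 ^ n}" "j \<in> {..<2 ^ n}" "gray i = gray j"
  have "bit i k = bit j k" for k
    using up_gray[of i n k] up_gray[of j n k] not_bit_ge[of i n k] not_bit_ge[of j n k] ij
    by (cases "k \<le> n") auto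
  then show "i = j" by (simp add: bit_eq_iff)
qed

lemma gray_image: "gray ` {..<2 ^ n} = Pow {..<n}"
proof (rule card_subset_eq)
  show "card (gray ` {..<2 ^ n}) = card (Pow {..<n})"
    by (simp add: card_image[OF gray_inj] card_Pow)
qed (use gray_subset in auto)

text \<open>The carry of an increment runs through the trailing ones and stops at the least zero bit
  \<open>k\<close>.\<close>

lemma bit_Suc_least:
  assumes "\<not> bit i k" "\<And>j. j < k \<Longrightarrow> bit i j"
  shows "bit (Suc i) j \<longleftrightarrow> bit i j \<noteq> (j \<le> k)"
  using assms
proof (induction k arbitrary: i j)
  case 0
  then have "even i" by (simp add: bit_0)
  then show ?case using 0 by (cases j) (auto simp: bit_0 bit_Suc)
next
  case (Suc k)
  then have odd: "odd i" using Suc.prems(2)[of 0] by (simp add: bit_0)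
  have "\<not> bit (i div 2) k" "\<And>j. j < k \<Longrightarrow> bit (i div 2) j"
    using Suc.prems by (auto simp flip: bit_Suc)
  note IH = Suc.IH[OF this]
  have "Suc i div 2 = Suc (i div 2)" using odd by presburger
  then show ?case using IH odd by (cases j) (auto simp: bit_0 bit_Suc)
qed

text \<open>The increment complements all bits up to \<open>k\<close>, so among adjacent pairs only
  the comparison of bits \<open>k\<close> and \<open>k + 1\<close> changes.\<close>

lemma gray_Suc:
  assumes "\<not> bit i k" "\<And>j. j < k \<Longrightarrow> bit i j"
  shows "gray (Suc i) = flip k (gray i)"
proof (rule set_eqI)
  fix j
  have "(j \<le> k) \<noteq> (Suc j \<le> k) \<longleftrightarrow> j = k" by auto
  moreover have *: "bit (Suc i) l \<longleftrightarrow> bit i l \<noteq> (l \<le> k)" for l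
    by (rule bit_Suc_least) (use assms in auto)
  ultimately show "j \<in> gray (Suc i) \<longleftrightarrow> j \<in> flip k (gray i)"
    unfolding gray_def mem_flip mem_Collect_eq * by argo
qed

lemma last_bits: "(i::nat) < 2 ^ n \<Longrightarrow> (\<And>k. k < n \<Longrightarrow> bit i k) \<Longrightarrow> Suc i = 2 ^ n"
proof -
  assume i: "i < 2 ^ n" "\<And>k. k < n \<Longrightarrow> bit i k"
  have "i = mask n"
  proof (rule bit_eqI)
    fix k show "bit i k \<longleftrightarrow> bit (mask n :: nat) k"
      using i(2)[of k] not_bit_ge[OF i(1), of k] by (cases "k < n") (simp_all add: bit_mask_iff)
  qed
  then show ?thesis by (simp add: mask_eq_exp_minus_1)
qed

lemma bit_pred_exp: "bit (2 ^ n - 1 :: nat) k \<longleftrightarrow> k < n"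
  using bit_mask_iff[of n k, where 'a=nat] by (simp add: mask_eq_exp_minus_1)

lemma gray_last: "gray (2 ^ Suc m - 1) = {m}"
  unfolding gray_def bit_pred_exp by auto

subsection \<open>The deformed cube\<close>

text \<open>A pair \<open>(k, s)\<close> names one facet inequality: the upper bound of coordinate
  \<open>k\<close> if \<open>s\<close> holds, else the lower bound. Thus \<open>of_bool s\<close> is
  the parameter value at which it is tight.\<close>

definition indices :: "nat \<Rightarrow> (nat \<times> bool) set" where
  "indices n = {..<n} \<times> UNIV"

definition inbox :: "nat \<Rightarrow> (nat \<Rightarrow> real) \<Rightarrow> bool" where
  "inbox n \<theta> \<longleftrightarrow> (\<forall>k<n. 0 \<le> \<theta> k \<and> \<theta> k \<le> 1)"

text \<open>The index type carries no order, but the cube is built recursively, one coordinate after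
  another.\<close>

locale coordinate_enumeration =
  fixes e :: "nat \<Rightarrow> 'n::finite"
  assumes bij_e: "bij_betw e {..<CARD('n)} UNIV"
begin

definition index :: "'n \<Rightarrow> nat" where
  "index = the_inv_into {..<CARD('n)} e"

definition box_slack :: "nat \<times> bool \<Rightarrow> real ^ 'n \<Rightarrow> real" where
  "box_slack i x = (if snd i then 1 - x $ e (fst i) else x $ e (fst i))"

definition slack :: "nat \<times> bool \<Rightarrow> real ^ 'n \<Rightarrow> real" where
  "slack i x = (if snd i then 3 ^ fst i - 2 * (\<Sum>j<fst i. x $ e j) - x $ e (fst i) else x $ e (fst i))"

definition deformed_cube :: "(real ^ 'n) set" where
  "deformed_cube = {x. \<forall>i\<in>indices CARD('n). 0 \<le> slack i x}"

definition deform :: "(nat \<Rightarrow> real) \<Rightarrow> real ^ 'n" where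
  "deform \<theta> = (\<chi> i. coord \<theta> (index i))"

section \<open>Parametrization of the deformed cube by the unit box\<close>

lemma index_e: "k < CARD('n) \<Longrightarrow> index (e k) = k"
  using bij_e unfolding index_def by (simp add: bij_betw_def the_inv_into_f_f)

lemma index_less: "index i < CARD('n)"
  using bij_e the_inv_into_into[of e "{..<CARD('n)}" i "{..<CARD('n)}"]
  unfolding index_def bij_betw_def by auto

lemma e_index: "e (index i) = i"
  using bij_e f_the_inv_into_f_bij_betw[OF bij_e] unfolding index_def by auto

lemma sum_index: "(\<Sum>i\<in>UNIV. f i) = (\<Sum>k<CARD('n). f (e k))"
  using sum.reindex_bij_betw[OF bij_e, of f] by simp

lemma vec_eq_e: "x = y \<longleftrightarrow> (\<forall>k<CARD('n). x $ e k = y $ e k)" for x y :: "'b ^ 'n"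
  by (metis e_index index_less vec_eq_iff)

lemma deform_e: "k < CARD('n) \<Longrightarrow> deform \<theta> $ e k = coord \<theta> k"
  by (simp add: deform_def index_e)

lemma sum_deform: "k \<le> CARD('n) \<Longrightarrow> (\<Sum>j<k. deform \<theta> $ e j) = psum \<theta> k"
  unfolding sum_coord[symmetric] by (intro sum.cong) (auto simp: deform_e)

lemma deform_cong: "(\<And>k. k < CARD('n) \<Longrightarrow> \<theta> k = \<theta>' k) \<Longrightarrow> deform \<theta> = deform \<theta>'"
  unfolding vec_eq_e by (auto simp: deform_e intro!: coord_cong)

text \<open>Each slack is the corresponding box slack times the length of the interval, which is
  positive on the box. Hence deformation preserves active constraints.\<close>

lemma slack_deform:
  assumes "k < CARD('n)"
  shows "slack (k, s) (deform \<theta>) = (if s then 1 - \<theta> k else \<theta> k) * (3 ^ k - 2 * psum \<theta> k)"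
  unfolding slack_def fst_conv snd_conv deform_e[OF assms] sum_deform[OF less_imp_le[OF assms]]
  by (simp add: coord_def algebra_simps)

lemma inbox_gap: "inbox CARD('n) \<theta> \<Longrightarrow> k < CARD('n) \<Longrightarrow> 0 < 3 ^ k - 2 * psum \<theta> k"
  using psum_bounds[of k \<theta>] by (auto simp: inbox_def)

lemma deform_in: "inbox CARD('n) \<theta> \<Longrightarrow> deform \<theta> \<in> deformed_cube"
  unfolding deformed_cube_def indices_def
  using inbox_gap[of \<theta>] by (auto simp: slack_deform inbox_def less_imp_le)

lemma slack_deform_0:
  "inbox CARD('n) \<theta> \<Longrightarrow> k < CARD('n) \<Longrightarrow> slack (k, s) (deform \<theta>) = 0 \<longleftrightarrow> \<theta> k = of_bool s"
  using inbox_gap[of \<theta> k] by (auto simp: slack_deform)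

text \<open>The map is triangular: once the earlier parameters agree, dividing coordinate
  \<open>k\<close> by its positive interval length recovers \<open>\<theta> k\<close>.\<close>

lemma deform_inj:
  assumes "inbox CARD('n) \<theta>" "inbox CARD('n) \<theta>'" "deform \<theta> = deform \<theta>'"
  shows "k < CARD('n) \<Longrightarrow> \<theta> k = \<theta>' k"
proof (induction k rule: less_induct)
  case (less k)
  then have "psum \<theta> k = psum \<theta>' k" by (intro psum_cong) auto
  moreover have "coord \<theta> k = coord \<theta>' k"
    using assms(3) less.prems by (metis deform_e)
  ultimately show ?case
    using inbox_gap[OF assms(1) less.prems] by (simp add: coord_def)
qed

lemma deform_surj:
  assumes "x \<in> deformed_cube"
  obtains \<theta> where "inbox CARD('n) \<theta>" "x = deform \<theta>"
proof -
  define \<theta> where "\<theta> k = x $ e k / (3 ^ k - 2 * (\<Sum>j<k. x $ e j))" for k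
  have x: "0 \<le> x $ e k" "x $ e k \<le> 3 ^ k - 2 * (\<Sum>j<k. x $ e j)" if "k < CARD('n)" for k
  proof -
    have "0 \<le> slack (k, s) x" for s using assms that by (simp add: deformed_cube_def indices_def)
    from this[of False] this[of True] show "0 \<le> x $ e k" "x $ e k \<le> 3 ^ k - 2 * (\<Sum>j<k. x $ e j)"
      by (simp_all add: slack_def)
  qed
  \<comment> \<open>Both claims go by one induction: the bounds on earlier parameters make the next
    interval length positive, which in turn bounds the next parameter.\<close>
  have *: "psum \<theta> k = (\<Sum>j<k. x $ e j) \<and> (\<forall>j<k. 0 \<le> \<theta> j \<and> \<theta> j \<le> 1)" if "k \<le> CARD('n)" for k
    using that
  proof (induction k)
    case (Suc k)
    then have IH: "psum \<theta> k = (\<Sum>j<k. x $ e j)" "\<forall>j<k. 0 \<le> \<theta> j \<and> \<theta> j \<le> 1" by auto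
    have gap: "0 < 3 ^ k - 2 * (\<Sum>j<k. x $ e j)"
      using psum_bounds[of k \<theta>] IH by simp
    have "0 \<le> \<theta> k" "\<theta> k \<le> 1"
      using x[of k] Suc.prems gap by (auto simp: \<theta>_def)
    moreover have "\<theta> k * (3 ^ k - 2 * (\<Sum>j<k. x $ e j)) = x $ e k"
      using gap by (simp add: \<theta>_def)
    ultimately show ?case using IH by (auto simp: less_Suc_eq)
  qed auto
  then have in_box: "inbox CARD('n) \<theta>" by (auto simp: inbox_def)
  have "x $ e k = deform \<theta> $ e k" if "k < CARD('n)" for k
    using *[of k] that inbox_gap[OF in_box that] by (simp add: deform_e coord_def \<theta>_def)
  then show ?thesis using that[OF in_box] vec_eq_e by blast
qed

lemma slack_affine:
  "slack i ((1 - t) *\<^sub>R x + t *\<^sub>R y) = (1 - t) * slack i x + t * slack i y"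
proof -
  have *: "(\<Sum>j<k. ((1 - t) *\<^sub>R x + t *\<^sub>R y) $ e j) = (1 - t) * (\<Sum>j<k. x $ e j) + t * (\<Sum>j<k. y $ e j)" for k
    by (simp add: sum.distrib sum_distrib_left)
  show ?thesis unfolding slack_def * by (simp add: algebra_simps)
qed

lemma box_slack_affine:
  "box_slack i ((1 - t) *\<^sub>R x + t *\<^sub>R y) = (1 - t) * box_slack i x + t * box_slack i y"
  by (simp add: box_slack_def algebra_simps)

lemma finite_indices: "finite (indices n)"
  by (simp add: indices_def)

lemma cbox_eq_box_slack: "cbox 0 1 = {x. \<forall>i\<in>indices CARD('n). 0 \<le> box_slack i x}"
proof (rule set_eqI)
  fix x :: "real ^ 'n"
  have "x \<in> cbox 0 1 \<longleftrightarrow> (\<forall>i. 0 \<le> x $ i \<and> x $ i \<le> 1)"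
    by (simp add: mem_box_cart)
  also have "\<dots> \<longleftrightarrow> (\<forall>k<CARD('n). 0 \<le> x $ e k \<and> x $ e k \<le> 1)"
    by (metis e_index index_less)
  also have "\<dots> \<longleftrightarrow> x \<in> {x. \<forall>i\<in>indices CARD('n). 0 \<le> box_slack i x}"
    by (auto simp: box_slack_def indices_def)
  finally show "x \<in> cbox 0 1 \<longleftrightarrow> x \<in> {x. \<forall>i\<in>indices CARD('n). 0 \<le> box_slack i x}" .
qed

lemma deformed_cube_isomorphic:
  "face_lattice_isomorphic (cbox 0 1 :: (real ^ 'n) set) deformed_cube"
  unfolding cbox_eq_box_slack deformed_cube_def
proof (rule face_lattice_isomorphic_active_set)
  let ?\<psi> = "\<lambda>x. deform (\<lambda>k. x $ e k)"
  have inbox_iff: "inbox CARD('n) (\<lambda>k. x $ e k) \<longleftrightarrow> (\<forall>i\<in>indices CARD('n). 0 \<le> box_slack i x)" for x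
    by (auto simp: inbox_def box_slack_def indices_def)
  show "bij_betw ?\<psi> {x. \<forall>i\<in>indices CARD('n). 0 \<le> box_slack i x} {x. \<forall>i\<in>indices CARD('n). 0 \<le> slack i x}"
    unfolding inbox_iff[symmetric] deformed_cube_def[symmetric] bij_betw_def
  proof (intro conjI inj_onI equalityI subsetI)
    fix x y assume "x \<in> {x. inbox CARD('n) (\<lambda>k. x $ e k)}" "y \<in> {x. inbox CARD('n) (\<lambda>k. x $ e k)}" "?\<psi> x = ?\<psi> y"
    then have "x $ e k = y $ e k" if "k < CARD('n)" for k
      using deform_inj[of "\<lambda>k. x $ e k" "\<lambda>k. y $ e k" k] that by simp
    then show "x = y" unfolding vec_eq_e by blast
  next
    fix x assume "x \<in> deformed_cube"
    then obtain \<theta> where \<theta>: "inbox CARD('n) \<theta>" "x = deform \<theta>" by (rule deform_surj)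
    define y where "y = (\<chi> i. \<theta> (index i))"
    have y: "y $ e k = \<theta> k" if "k < CARD('n)" for k
      using that by (simp add: y_def index_e)
    then have "inbox CARD('n) (\<lambda>k. y $ e k)" using \<theta>(1) by (simp add: inbox_def)
    moreover have "x = ?\<psi> y" unfolding \<theta>(2) using y by (intro deform_cong) simp
    ultimately show "x \<in> ?\<psi> ` {x. inbox CARD('n) (\<lambda>k. x $ e k)}" by blast
  qed (auto intro: deform_in)
  fix i x assume "i \<in> indices CARD('n)" "\<forall>i\<in>indices CARD('n). 0 \<le> box_slack i x"
  then show "slack i (?\<psi> x) = 0 \<longleftrightarrow> box_slack i x = 0"
    unfolding inbox_iff[symmetric]
    by (cases i) (auto simp: indices_def slack_deform_0 box_slack_def)
qed (rule box_slack_affine slack_affine finite_indices)+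

text \<open>A constraint defining \<open>F\<close> is tight at both given points, so it forces a
  common parameter 0 or 1, which \<open>\<theta>''\<close> shares. This serves to move inside a face
  by changing single parameters.\<close>

lemma face_of_deformed_cube_mem:
  assumes F: "F face_of deformed_cube" and in_box: "inbox CARD('n) \<theta>" "inbox CARD('n) \<theta>'" "inbox CARD('n) \<theta>''"
    and mem: "deform \<theta> \<in> F" "deform \<theta>' \<in> F"
    and eq: "\<And>k. k < CARD('n) \<Longrightarrow> \<theta> k = \<theta>' k \<Longrightarrow> \<theta> k = 0 \<or> \<theta> k = 1 \<Longrightarrow> \<theta>'' k = \<theta> k"
  shows "deform \<theta>'' \<in> F"
proof -
  have "F \<in> faces {x. \<forall>i\<in>indices CARD('n). 0 \<le> slack i x}"
    using F by (simp add: faces_def deformed_cube_def)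
  then obtain J where J: "J \<subseteq> indices CARD('n)" "F = {x. (\<forall>i\<in>indices CARD('n). 0 \<le> slack i x) \<and> (\<forall>i\<in>J. slack i x = 0)}"
    using mem unfolding faces_eq_active_sets[of "indices CARD('n)" slack, OF slack_affine finite_indices] by auto
  have "slack i (deform \<theta>'') = 0" if "i \<in> J" for i
  proof (cases i)
    case (Pair k s)
    then have k: "k < CARD('n)" using J(1) that by (auto simp: indices_def)
    then have "\<theta> k = of_bool s" "\<theta>' k = of_bool s"
      using mem that in_box unfolding J(2) Pair by (auto simp: slack_deform_0)
    then have "\<theta>'' k = of_bool s" using eq[OF k] by auto
    then show ?thesis using in_box k Pair by (simp add: slack_deform_0)
  qed
  moreover have "\<forall>i\<in>indices CARD('n). 0 \<le> slack i (deform \<theta>'')"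
    using deform_in[OF in_box(3)] by (simp add: deformed_cube_def)
  ultimately show ?thesis unfolding J(2) by simp
qed

section \<open>Vertices of the deformed cube\<close>

definition vertex :: "nat set \<Rightarrow> real ^ 'n" where
  "vertex b = deform (bits b)"

lemma inbox_bits: "inbox CARD('n) (bits b)"
  by (auto simp: inbox_def)

lemma vertex_eq: "b \<subseteq> {..<CARD('n)} \<Longrightarrow> b' \<subseteq> {..<CARD('n)} \<Longrightarrow> vertex b = vertex b' \<longleftrightarrow> b = b'"
proof
  assume b: "b \<subseteq> {..<CARD('n)}" "b' \<subseteq> {..<CARD('n)}" "vertex b = vertex b'"
  have "k \<in> b \<longleftrightarrow> k \<in> b'" if "k < CARD('n)" for k
    using deform_inj[OF inbox_bits inbox_bits, of b b'] b(3) that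
    by (auto simp: vertex_def of_bool_eq_iff)
  then show "b = b'" using b by blast
qed auto

lemma cube_face:
  assumes "S \<subseteq> {..<CARD('n)}"
  shows "{x\<in>deformed_cube. \<forall>k\<in>S. slack (k, k \<in> b) x = 0} face_of deformed_cube"
proof -
  have "{x. (\<forall>i\<in>indices CARD('n). 0 \<le> slack i x) \<and> (\<forall>i\<in>(\<lambda>k. (k, k \<in> b)) ` S. slack i x = 0)}
      face_of {x. \<forall>i\<in>indices CARD('n). 0 \<le> slack i x}"
    by (rule active_set_face_of) (use assms in \<open>auto simp: slack_affine indices_def\<close>)
  then show ?thesis by (simp add: deformed_cube_def)
qed

lemma extreme_point_of_deformed_cube:
  "x extreme_point_of deformed_cube \<longleftrightarrow> (\<exists>b\<subseteq>{..<CARD('n)}. x = vertex b)"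
proof
  assume x: "x extreme_point_of deformed_cube"
  then obtain \<theta> where \<theta>: "inbox CARD('n) \<theta>" "x = deform \<theta>"
    by (metis deform_surj extreme_point_of_def)
  have face: "{deform \<theta>} face_of deformed_cube"
    using x \<theta> by (simp add: face_of_singleton)
  have "\<theta> k = 0 \<or> \<theta> k = 1" if k: "k < CARD('n)" for k
  proof (rule ccontr)
    assume *: "\<not> (\<theta> k = 0 \<or> \<theta> k = 1)"
    \<comment> \<open>A parameter strictly between 0 and 1 could be reset to 0 without leaving the
      singleton face, contradicting injectivity.\<close>
    have in_box: "inbox CARD('n) (\<theta>(k := 0))" using \<theta>(1) by (simp add: inbox_def)
    have "deform (\<theta>(k := 0)) \<in> {deform \<theta>}"
      using face \<theta>(1) \<theta>(1) in_box by (rule face_of_deformed_cube_mem) (use * in auto)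
    then show False using deform_inj[OF in_box \<theta>(1) _ k] * by auto
  qed
  then have "deform \<theta> = deform (bits {k\<in>{..<CARD('n)}. \<theta> k = 1})"
    by (intro deform_cong) fastforce
  then show "\<exists>b\<subseteq>{..<CARD('n)}. x = vertex b"
    unfolding \<theta>(2) vertex_def by (intro exI[of _ "{k\<in>{..<CARD('n)}. \<theta> k = 1}"]) auto
next
  assume "\<exists>b\<subseteq>{..<CARD('n)}. x = vertex b"
  then obtain b where b: "x = vertex b" by blast
  have "y \<in> {vertex b}" if y: "y \<in> deformed_cube" and s: "\<forall>k\<in>{..<CARD('n)}. slack (k, k \<in> b) y = 0" for y
  proof -
    obtain \<theta> where \<theta>: "inbox CARD('n) \<theta>" "y = deform \<theta>" by (rule deform_surj[OF y])
    have "deform \<theta> = deform (bits b)"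
      using s \<theta> by (intro deform_cong) (simp add: slack_deform_0)
    then show ?thesis by (simp add: vertex_def \<theta>(2))
  qed
  moreover have "slack (k, k \<in> b) (vertex b) = 0" if "k < CARD('n)" for k
    unfolding vertex_def slack_deform_0[OF inbox_bits that] ..
  moreover have "vertex b \<in> deformed_cube"
    unfolding vertex_def by (rule deform_in[OF inbox_bits])
  ultimately have "{x\<in>deformed_cube. \<forall>k\<in>{..<CARD('n)}. slack (k, k \<in> b) x = 0} = {x}"
    unfolding b by blast
  then show "x extreme_point_of deformed_cube"
    using cube_face[of "{..<CARD('n)}" b] by (simp add: face_of_singleton)
qed

lemma vertices_deformed_cube: "vertices deformed_cube = vertex ` Pow {..<CARD('n)}"
  by (auto simp: vertices_def extreme_point_of_deformed_cube)

section \<open>Compactness, polytope property and dimension\<close>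

lemma convex_deformed_cube: "convex deformed_cube"
  unfolding convex_alt deformed_cube_def by (simp add: slack_affine)

lemma continuous_on_slack: "continuous_on UNIV (slack i)"
  unfolding slack_def by (cases "snd i"; simp; intro continuous_intros)

lemma compact_deformed_cube: "compact deformed_cube"
proof -
  have "closed deformed_cube"
    unfolding deformed_cube_def Ball_def
    by (intro closed_Collect_all closed_Collect_imp open_Collect_const closed_Collect_le
        continuous_on_slack continuous_on_const)
  moreover have "bounded deformed_cube"
  proof (rule bounded_subset)
    show "deformed_cube \<subseteq> cbox 0 (\<chi> i. 3 ^ CARD('n))"
    proof
      fix x assume "x \<in> deformed_cube"
      then obtain \<theta> where \<theta>: "inbox CARD('n) \<theta>" "x = deform \<theta>" by (rule deform_surj)
      have "0 \<le> coord \<theta> k \<and> coord \<theta> k \<le> 3 ^ CARD('n)" if k: "k < CARD('n)" for k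
      proof -
        have "0 \<le> \<theta> k" "\<theta> k \<le> 1" using \<theta>(1) k by (auto simp: inbox_def)
        moreover have "0 \<le> psum \<theta> k" using psum_bounds[of k \<theta>] \<theta>(1) k by (auto simp: inbox_def)
        moreover have "(3::real) ^ k \<le> 3 ^ CARD('n)" using k by (simp add: power_increasing)
        moreover have "coord \<theta> k \<le> 3 ^ k - 2 * psum \<theta> k"
          unfolding coord_def using inbox_gap[OF \<theta>(1) k] \<open>0 \<le> \<theta> k\<close> \<open>\<theta> k \<le> 1\<close>
          by (intro mult_left_le_one_le) auto
        moreover have "0 \<le> coord \<theta> k"
          unfolding coord_def using inbox_gap[OF \<theta>(1) k] \<open>0 \<le> \<theta> k\<close> by simp
        ultimately show ?thesis by linarith
      qed
      then show "x \<in> cbox 0 (\<chi> i. 3 ^ CARD('n))"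
        by (simp add: mem_box_cart \<theta>(2) deform_def index_less)
    qed
  qed auto
  ultimately show ?thesis by (simp add: compact_eq_bounded_closed)
qed

text \<open>Krein-Milman turns the description by inequalities into the hull of the finitely many
  vertices.\<close>

lemma polytope_deformed_cube: "polytope deformed_cube"
proof -
  have "deformed_cube = convex hull (vertices deformed_cube)"
    unfolding vertices_def by (rule Krein_Milman_Minkowski[OF compact_deformed_cube convex_deformed_cube])
  moreover have "finite (vertices deformed_cube)" by (simp add: vertices_deformed_cube)
  ultimately show ?thesis unfolding polytope_def by blast
qed

lemma aff_dim_deformed_cube: "aff_dim deformed_cube = int CARD('n)"
proof -
  define U where "U = (\<Inter>i\<in>indices CARD('n). {x. 0 < slack i x})"
  have "open U"
    unfolding U_def using finite_indices
    by (intro open_INT ballI open_Collect_less continuous_on_slack continuous_on_const)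
  moreover have "U \<subseteq> deformed_cube" unfolding U_def deformed_cube_def by (auto simp: less_imp_le)
  \<comment> \<open>At the center of the box every slack is half of a positive interval
    length.\<close>
  moreover have "deform (\<lambda>_. 1/2) \<in> U"
    using inbox_gap[of "\<lambda>_. 1/2"] by (auto simp: U_def indices_def slack_deform inbox_def)
  ultimately have "interior deformed_cube \<noteq> {}"
    using interior_maximal by blast
  then show ?thesis by (simp add: aff_dim_nonempty_interior)
qed

section \<open>Edges and improving neighbors\<close>

lemma flip_subset: "b \<subseteq> {..<n} \<Longrightarrow> k < n \<Longrightarrow> flip k b \<subseteq> {..<n}"
  by (auto simp: mem_flip)

text \<open>Fixing every bit except \<open>k\<close> cuts out a face whose only extreme points are
  the two given vertices, so by Krein-Milman it is their segment.\<close>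

lemma edge_of_deformed_cube:
  assumes b: "b \<subseteq> {..<CARD('n)}" and k: "k < CARD('n)"
  shows "closed_segment (vertex b) (vertex (flip k b)) edge_of deformed_cube"
proof -
  define F where "F = {x\<in>deformed_cube. \<forall>j\<in>{..<CARD('n)} - {k}. slack (j, j \<in> b) x = 0}"
  have face: "F face_of deformed_cube" unfolding F_def by (rule cube_face) auto
  have mem: "vertex b' \<in> F \<longleftrightarrow> (\<forall>j\<in>{..<CARD('n)} - {k}. (j \<in> b') = (j \<in> b))" for b'
  proof -
    have "slack (j, j \<in> b) (vertex b') = 0 \<longleftrightarrow> (j \<in> b') = (j \<in> b)" if "j < CARD('n)" for j
      unfolding vertex_def slack_deform_0[OF inbox_bits that] by simp
    moreover have "vertex b' \<in> deformed_cube"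
      unfolding vertex_def by (rule deform_in[OF inbox_bits])
    ultimately show ?thesis unfolding F_def by simp
  qed
  have "{x. x extreme_point_of F} = {vertex b, vertex (flip k b)}"
  proof (intro equalityI subsetI)
    fix x assume "x \<in> {x. x extreme_point_of F}"
    then have x: "x extreme_point_of deformed_cube" "x \<in> F"
      unfolding mem_Collect_eq extreme_point_of_face[OF face] by simp_all
    from x(1) obtain b' where b': "b' \<subseteq> {..<CARD('n)}" "x = vertex b'"
      unfolding extreme_point_of_deformed_cube by (elim exE conjE)
    have b'_eq: "j \<in> b' \<longleftrightarrow> j \<in> b" if "j \<noteq> k" for j
      using x(2) b b'(1) that unfolding b'(2) mem by blast
    have "b' = b \<or> b' = flip k b"
    proof (cases "(k \<in> b') = (k \<in> b)")
      case True
      then have "j \<in> b' \<longleftrightarrow> j \<in> b" for j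
        using b'_eq by (cases "j = k") auto
      then have "b' = b" by (rule set_eqI)
      then show ?thesis ..
    next
      case False
      then have "j \<in> b' \<longleftrightarrow> j \<in> flip k b" for j
        using b'_eq unfolding mem_flip by (cases "j = k") auto
      then have "b' = flip k b" by (rule set_eqI)
      then show ?thesis ..
    qed
    then show "x \<in> {vertex b, vertex (flip k b)}" using b' by auto
  next
    fix x assume x: "x \<in> {vertex b, vertex (flip k b)}"
    have "vertex b \<in> F" "vertex (flip k b) \<in> F"
      unfolding mem by (simp_all add: mem_flip)
    moreover have "vertex b extreme_point_of deformed_cube" "vertex (flip k b) extreme_point_of deformed_cube"
      using b flip_subset[OF b k] unfolding extreme_point_of_deformed_cube by blast+
    ultimately show "x \<in> {x. x extreme_point_of F}"
      using x unfolding extreme_point_of_face[OF face] mem_Collect_eq by blast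
  qed
  moreover have "F = convex hull {x. x extreme_point_of F}"
    using face_of_imp_compact[OF convex_deformed_cube compact_deformed_cube face]
      face_of_imp_convex[OF face] by (rule Krein_Milman_Minkowski)
  ultimately have F: "F = closed_segment (vertex b) (vertex (flip k b))"
    by (simp add: segment_convex_hull)
  have "b \<noteq> flip k b" by (auto simp: set_eq_iff mem_flip)
  then have "vertex b \<noteq> vertex (flip k b)" using vertex_eq[OF b flip_subset[OF b k]] by simp
  then have "aff_dim F = 1" by (simp add: F segment_convex_hull aff_dim_convex_hull aff_dim_2)
  then show ?thesis using face unfolding edge_of_def F by simp
qed

text \<open>If the ends differ at \<open>k\<close>, flipping \<open>k\<close> in \<open>b\<close>
  stays in the face. The result is a vertex of the segment other than \<open>vertex b\<close>, so it
  is the other end.\<close>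

lemma edge_of_deformed_cubeD:
  assumes b: "b \<subseteq> {..<CARD('n)}" "b' \<subseteq> {..<CARD('n)}"
    and edge: "closed_segment (vertex b) (vertex b') edge_of deformed_cube" and "b \<noteq> b'"
  obtains k where "k < CARD('n)" "b' = flip k b"
proof -
  obtain k where k: "(k \<in> b) \<noteq> (k \<in> b')" using \<open>b \<noteq> b'\<close> by blast
  then have k_less: "k < CARD('n)" using b by auto
  have face: "closed_segment (vertex b) (vertex b') face_of deformed_cube"
    using edge by (simp add: edge_of_def)
  have "vertex (flip k b) \<in> closed_segment (vertex b) (vertex b')"
    unfolding vertex_def
    by (rule face_of_deformed_cube_mem[where \<theta>="bits b" and \<theta>'="bits b'",
          OF face[unfolded vertex_def] inbox_bits inbox_bits inbox_bits])
      (use k in \<open>auto simp: mem_flip of_bool_eq_iff\<close>)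
  moreover have "vertex (flip k b) extreme_point_of deformed_cube"
    unfolding extreme_point_of_deformed_cube using flip_subset[OF b(1) k_less] by (intro exI conjI) auto
  ultimately have "vertex (flip k b) extreme_point_of closed_segment (vertex b) (vertex b')"
    using extreme_point_of_face[OF face] by simp
  then have "flip k b = b \<or> flip k b = b'"
    using vertex_eq[OF flip_subset[OF b(1) k_less]] b by (simp add: extreme_point_of_segment)
  moreover have "flip k b \<noteq> b" by (auto simp: set_eq_iff mem_flip)
  ultimately show ?thesis using that k_less by blast
qed

lemma inner_one_vertex: "1 \<bullet> vertex b = psum (bits b) CARD('n)"
  unfolding inner_vec_def sum_index by (simp add: sum_deform vertex_def)

lemma improving_neighbors_deformed_cube:
  assumes b: "b \<subseteq> {..<CARD('n)}"
  shows "improving_neighbors deformed_cube 1 (vertex b)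
    = (\<lambda>k. vertex (flip k b)) ` {k\<in>{..<CARD('n)}. up CARD('n) b k}"
proof (intro equalityI subsetI)
  fix u assume "u \<in> improving_neighbors deformed_cube 1 (vertex b)"
  then obtain b' where b': "b' \<subseteq> {..<CARD('n)}" "u = vertex b'"
    "closed_segment (vertex b) u edge_of deformed_cube" "1 \<bullet> vertex b < 1 \<bullet> u"
    by (auto simp: improving_neighbors_def vertices_deformed_cube)
  then have "b \<noteq> b'" by auto
  then obtain k where "k < CARD('n)" "b' = flip k b"
    using edge_of_deformed_cubeD b b' by blast
  moreover from this have "up CARD('n) b k"
    using psum_flip(1)[of k "CARD('n)" b] b' by (auto simp: inner_one_vertex split: if_splits)
  ultimately show "u \<in> (\<lambda>k. vertex (flip k b)) ` {k\<in>{..<CARD('n)}. up CARD('n) b k}"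
    using b' by blast
next
  fix u assume "u \<in> (\<lambda>k. vertex (flip k b)) ` {k\<in>{..<CARD('n)}. up CARD('n) b k}"
  then obtain k where k: "k < CARD('n)" "up CARD('n) b k" "u = vertex (flip k b)" by auto
  then show "u \<in> improving_neighbors deformed_cube 1 (vertex b)"
    using edge_of_deformed_cube[OF b k(1)] flip_subset[OF b k(1)] psum_flip(1)[OF k(1), of b]
    by (auto simp: improving_neighbors_def vertices_deformed_cube inner_one_vertex)
qed

end

subsection \<open>Linear images\<close>

lemma face_lattice_isomorphic_sym:
  assumes "face_lattice_isomorphic P Q"
  shows "face_lattice_isomorphic Q P"
proof -
  obtain \<phi> where \<phi>: "bij_betw \<phi> (faces P) (faces Q)"
    "\<forall>F\<in>faces P. \<forall>G\<in>faces P. F \<subseteq> G \<longleftrightarrow> \<phi> F \<subseteq> \<phi> G"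
    using assms unfolding face_lattice_isomorphic_def by (elim exE conjE) (rule that)
  let ?\<psi> = "inv_into (faces P) \<phi>"
  have "F \<subseteq> G \<longleftrightarrow> ?\<psi> F \<subseteq> ?\<psi> G" if "F \<in> faces Q" "G \<in> faces Q" for F G
  proof -
    have "?\<psi> F \<in> faces P" "?\<psi> G \<in> faces P" "\<phi> (?\<psi> F) = F" "\<phi> (?\<psi> G) = G"
      using that \<phi>(1) by (auto simp: bij_betw_def inv_into_into f_inv_into_f)
    then show ?thesis using \<phi>(2) by metis
  qed
  then show ?thesis
    unfolding face_lattice_isomorphic_def using bij_betw_inv_into[OF \<phi>(1)]
    by (intro exI[of _ ?\<psi>]) simp
qed

lemma face_lattice_isomorphic_linear_image:
  fixes f :: "'b::real_vector \<Rightarrow> 'c::real_vector"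
  assumes f: "linear f" "inj f" and "face_lattice_isomorphic P Q"
  shows "face_lattice_isomorphic P (f ` Q)"
proof -
  obtain \<phi> where \<phi>: "bij_betw \<phi> (faces P) (faces Q)"
    "\<forall>F\<in>faces P. \<forall>G\<in>faces P. F \<subseteq> G \<longleftrightarrow> \<phi> F \<subseteq> \<phi> G"
    using assms unfolding face_lattice_isomorphic_def by (elim exE conjE) (rule that)
  have "faces (f ` Q) = (`) f ` faces Q"
    unfolding faces_def by (rule faces_of_linear_image[OF f])
  moreover have "inj_on ((`) f) (faces Q)"
    using f(2) by (simp add: inj_on_def inj_image_eq_iff)
  ultimately have "bij_betw ((`) f) (faces Q) (faces (f ` Q))"
    by (simp add: bij_betw_def)
  then have "bij_betw ((`) f \<circ> \<phi>) (faces P) (faces (f ` Q))"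
    by (rule bij_betw_trans[OF \<phi>(1)])
  then show ?thesis
    unfolding face_lattice_isomorphic_def
    by (intro exI[of _ "(`) f \<circ> \<phi>"]) (simp add: \<phi>(2) inj_image_subset_iff[OF f(2)])
qed

lemma vertices_linear_image:
  assumes "linear f" "inj f"
  shows "vertices (f ` P) = f ` vertices P"
proof -
  have "f x extreme_point_of f ` P \<longleftrightarrow> x extreme_point_of P" for x
    using face_of_linear_image[OF assms, of "{x}" P] by (simp add: face_of_singleton)
  moreover have "y \<in> f ` P" if "y extreme_point_of f ` P" for y
    using that by (simp add: extreme_point_of_def)
  ultimately show ?thesis unfolding vertices_def by blast
qed

lemma improving_neighbors_linear_image:
  assumes f: "linear f" "inj f" and c: "\<And>x. c \<bullet> f x = a \<bullet> x"
  shows "improving_neighbors (f ` P) c (f v) = f ` improving_neighbors P a v"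
proof -
  have "closed_segment (f v) (f u) edge_of f ` P \<longleftrightarrow> closed_segment v u edge_of P" for u
    by (simp add: edge_of_def closed_segment_linear_image[OF f(1)] face_of_linear_image[OF f]
        aff_dim_injective_linear_image[OF f])
  then show ?thesis
    unfolding improving_neighbors_def vertices_linear_image[OF f] using c by auto
qed

subsection \<open>The pivot rule on the rescaled cube\<close>

text \<open>Continuity along a ray, obtained from the reverse triangle inequality since \<eta> is an
  abstract norm.\<close>

lemma is_norm_perturb_tendsto:
  assumes "is_norm \<eta>"
  shows "((\<lambda>d. \<eta> (w + d *\<^sub>R x)) \<longlongrightarrow> \<eta> w) (at_right 0)"
proof -
  have tri: "\<eta> (x + y) \<le> \<eta> x + \<eta> y" and scale: "\<eta> (a *\<^sub>R x) = \<bar>a\<bar> * \<eta> x" for a x y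
    using assms unfolding is_norm_def by blast+
  have bound: "\<bar>\<eta> (w + d *\<^sub>R x) - \<eta> w\<bar> \<le> \<bar>d\<bar> * \<eta> x" for d
    using tri[of w "d *\<^sub>R x"] tri[of "w + d *\<^sub>R x" "(- d) *\<^sub>R x"] scale[of d x] scale[of "- d" x]
    by simp
  have "((\<lambda>d. \<bar>d\<bar> * \<eta> x) \<longlongrightarrow> \<bar>0\<bar> * \<eta> x) (at_right 0)"
    by (intro tendsto_intros)
  then have lim: "((\<lambda>d. \<bar>d\<bar> * \<eta> x) \<longlongrightarrow> 0) (at_right 0)"
    by simp
  have "((\<lambda>d. \<eta> (w + d *\<^sub>R x) - \<eta> w) \<longlongrightarrow> 0) (at_right 0)"
    by (rule Lim_null_comparison[OF _ lim]) (simp add: bound)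
  then show ?thesis by (simp add: LIM_zero_iff)
qed

lemma argmax_set_image_eq:
  assumes "x \<in> A" "\<And>y. y \<in> A \<Longrightarrow> y \<noteq> x \<Longrightarrow> g (f y) < g (f x)"
  shows "argmax_set g (f ` A) = {f x}"
  using assms unfolding argmax_set_def is_arg_max_def by (auto; metis less_asym less_irrefl)

context coordinate_enumeration
begin

definition weights :: "real ^ 'n" where
  "weights = (\<chi> i. 3 ^ index i)"

definition edge :: "nat set \<Rightarrow> nat \<Rightarrow> real ^ 'n" where
  "edge b k = vertex (flip k b) - vertex b"

text \<open>The all-ones vector serves as the direction \<open>q\<close>: it is nonzero, so
  \<open>\<eta> 1\<close> is positive, and \<open>weights \<bullet> 1\<close> is nonnegative, which
  gives injectivity for every positive \<open>d\<close>.\<close>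

definition stretch :: "real \<Rightarrow> real ^ 'n \<Rightarrow> real ^ 'n" where
  "stretch d x = (weights \<bullet> x) *\<^sub>R 1 + d *\<^sub>R x"

lemma inner_weights_vertex: "weights \<bullet> vertex b = (\<Sum>k<CARD('n). 3 ^ k * coord (bits b) k)"
  unfolding inner_vec_def sum_index by (intro sum.cong) (simp_all add: weights_def index_e deform_e vertex_def)

lemma inner_edge:
  assumes "k < CARD('n)" "up CARD('n) b k"
  shows "0 < 1 \<bullet> edge b k" "weights \<bullet> edge b k = slope CARD('n) b k * (1 \<bullet> edge b k)"
  using psum_flip[OF assms(1), of b] assms(2)
  by (simp_all add: edge_def inner_diff_right inner_one_vertex inner_weights_vertex)

lemma linear_stretch: "linear (stretch d)"
  by (intro linearI) (simp_all add: stretch_def inner_add_right algebra_simps)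

text \<open>Pairing with \<open>weights\<close> multiplies \<open>weights \<bullet> x\<close> by a
  positive number, so a kernel vector has \<open>weights \<bullet> x = 0\<close>, and only
  \<open>d *\<^sub>R x\<close> remains.\<close>

lemma inj_stretch:
  assumes "0 < d"
  shows "inj (stretch d)"
proof (rule linear_injective_0[OF linear_stretch, THEN iffD2, rule_format])
  fix x assume x: "stretch d x = 0"
  have "0 \<le> weights \<bullet> 1"
    by (simp add: weights_def inner_vec_def sum_nonneg)
  moreover have "(weights \<bullet> x) * (weights \<bullet> 1 + d) = weights \<bullet> stretch d x"
    by (simp add: stretch_def inner_add_right algebra_simps)
  ultimately have "weights \<bullet> x = 0" using x assms by auto
  then show "x = 0" using x assms by (simp add: stretch_def)
qed

text \<open>As \<open>d\<close> tends to 0, \<open>\<eta> (stretch d x)\<close> tends to \<open>\<bar>weights \<bullet> x\<bar> * \<eta> 1\<close>, so the pivot rule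
  compares reciprocals of slopes.\<close>

lemma eventually_stretch_order:
  assumes \<eta>: "is_norm \<eta>"
  shows "\<forall>\<^sub>F d in at_right 0. \<forall>b\<in>Pow {..<CARD('n)}. \<forall>k\<in>{..<CARD('n)}. \<forall>l\<in>{..<CARD('n)}.
    k < l \<and> up CARD('n) b k \<and> up CARD('n) b l \<longrightarrow>
    1 \<bullet> edge b l / \<eta> (stretch d (edge b l)) < 1 \<bullet> edge b k / \<eta> (stretch d (edge b k))"
proof (intro eventually_ball_finite ballI)
  fix b k l assume kl: "k \<in> {..<CARD('n)}" "l \<in> {..<CARD('n)}"
  show "\<forall>\<^sub>F d in at_right 0. k < l \<and> up CARD('n) b k \<and> up CARD('n) b l \<longrightarrow>
    1 \<bullet> edge b l / \<eta> (stretch d (edge b l)) < 1 \<bullet> edge b k / \<eta> (stretch d (edge b k))"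
  proof (cases "k < l \<and> up CARD('n) b k \<and> up CARD('n) b l")
    case True
    have "\<eta> 1 \<noteq> 0" "0 \<le> \<eta> 1" and scale: "\<eta> (a *\<^sub>R x) = \<bar>a\<bar> * \<eta> x" for a x
      using \<eta> zero_neq_one[where 'a="real ^ 'n"] unfolding is_norm_def by metis+
    then have pos: "0 < \<eta> 1" by linarith
    \<comment> \<open>The limiting norm is slope times objective gain times \<open>\<eta> 1\<close>.
      Slope and gain are positive, so the absolute value disappears and the gain cancels.\<close>
    have lim: "((\<lambda>d. 1 \<bullet> edge b j / \<eta> (stretch d (edge b j))) \<longlongrightarrow> 1 / (slope CARD('n) b j * \<eta> 1)) (at_right 0)"
      if j: "j < CARD('n)" "up CARD('n) b j" for j
    proof -
      have w: "\<eta> ((weights \<bullet> edge b j) *\<^sub>R 1) = slope CARD('n) b j * (1 \<bullet> edge b j) * \<eta> 1"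
        using inner_edge[OF j] slope_bounds[OF j(1), of b] by (simp add: scale)
      have "((\<lambda>d. 1 \<bullet> edge b j / \<eta> (stretch d (edge b j)))
          \<longlongrightarrow> 1 \<bullet> edge b j / (slope CARD('n) b j * (1 \<bullet> edge b j) * \<eta> 1)) (at_right 0)"
        unfolding stretch_def w[symmetric]
        by (intro tendsto_divide tendsto_const is_norm_perturb_tendsto[OF \<eta>])
          (use w pos inner_edge[OF j] slope_bounds[OF j(1), of b] in simp)
      then show ?thesis using inner_edge(1)[OF j] by simp
    qed
    have "slope CARD('n) b k < slope CARD('n) b l" "0 < slope CARD('n) b k"
      using slope_order[of k l "CARD('n)" b] slope_bounds[of k "CARD('n)" b] True kl by auto
    then have "1 / (slope CARD('n) b l * \<eta> 1) < 1 / (slope CARD('n) b k * \<eta> 1)"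
      using pos by (intro divide_strict_left_mono mult_strict_right_mono) auto
    \<comment> \<open>A strict inequality between the limits persists for all small
      \<open>d\<close>.\<close>
    then have "\<forall>\<^sub>F d in at_right 0.
        1 \<bullet> edge b l / \<eta> (stretch d (edge b l)) < 1 \<bullet> edge b k / \<eta> (stretch d (edge b k))"
      using order_tendstoD(1)[OF tendsto_diff[OF lim lim], of k l 0] True kl by simp
    then show ?thesis by eventually_elim simp
  next
    case False
    show ?thesis by (rule always_eventually) (use False in blast)
  qed
qed auto

text \<open>At \<open>gray i\<close> the improving bits are the zero bits of \<open>i\<close>. The
  ratio strictly decreases with the bit, so the least zero bit wins, and flipping it yields
  \<open>gray (Suc i)\<close>.\<close>

lemma pivot_run_stretch:
  assumes d: "0 < d"
    and order: "\<forall>b\<in>Pow {..<CARD('n)}. \<forall>k\<in>{..<CARD('n)}. \<forall>l\<in>{..<CARD('n)}.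
      k < l \<and> up CARD('n) b k \<and> up CARD('n) b l \<longrightarrow>
      1 \<bullet> edge b l / \<eta> (stretch d (edge b l)) < 1 \<bullet> edge b k / \<eta> (stretch d (edge b k))"
    and c: "\<And>x. c \<bullet> stretch d x = 1 \<bullet> x"
  shows "pivot_run \<eta> (stretch d ` deformed_cube) c (\<lambda>i. stretch d (vertex (gray i))) (2 ^ CARD('n) - 1)"
proof -
  note f = linear_stretch[of d] inj_stretch[OF d]
  have nbrs: "improving_neighbors (stretch d ` deformed_cube) c (stretch d (vertex (gray i)))
      = (\<lambda>k. stretch d (vertex (flip k (gray i)))) ` {k\<in>{..<CARD('n)}. \<not> bit i k}" if "i < 2 ^ CARD('n)" for i
    using improving_neighbors_linear_image[OF f c, of deformed_cube "vertex (gray i)"]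
      improving_neighbors_deformed_cube[OF gray_subset[OF that]] up_gray[OF that]
    by (auto simp: image_image)
  show ?thesis
    unfolding pivot_run_def
  proof (intro conjI allI impI)
    show "stretch d (vertex (gray 0)) \<in> vertices (stretch d ` deformed_cube)"
      using gray_subset[of 0 "CARD('n)"] unfolding vertices_linear_image[OF f] vertices_deformed_cube
      by simp
    show "improving_neighbors (stretch d ` deformed_cube) c (stretch d (vertex (gray (2 ^ CARD('n) - 1)))) = {}"
      by (subst nbrs) (auto simp: bit_pred_exp simp del: One_nat_def)
    fix i assume i: "i < 2 ^ CARD('n) - (1::nat)"
    then have i': "i < 2 ^ CARD('n)" "Suc i \<noteq> 2 ^ CARD('n)" by auto
    \<comment> \<open>Only \<open>2 ^ CARD('n) - 1\<close> has all its low bits set, so an improving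
      bit exists before the end of the run.\<close>
    then have "\<exists>k. k < CARD('n) \<and> \<not> bit i k" using last_bits by blast
    then obtain k where k: "k < CARD('n)" "\<not> bit i k" and least: "\<And>j. j < k \<Longrightarrow> \<not> (j < CARD('n) \<and> \<not> bit i j)"
      using exists_least_iff[of "\<lambda>k. k < CARD('n) \<and> \<not> bit i k"] by blast
    have bits: "bit i j" if "j < k" for j using least[OF that] that k by simp
    have gray_i: "gray (Suc i) = flip k (gray i)"
      by (rule gray_Suc[OF k(2)]) (rule bits)
    have diff: "stretch d (vertex (flip j (gray i))) - stretch d (vertex (gray i)) = stretch d (edge (gray i) j)" for j
      by (simp add: edge_def linear_diff[OF f(1)])
    show "argmax_set (\<lambda>u. c \<bullet> (u - stretch d (vertex (gray i))) / \<eta> (u - stretch d (vertex (gray i))))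
        (improving_neighbors (stretch d ` deformed_cube) c (stretch d (vertex (gray i))))
      = {stretch d (vertex (gray (Suc i)))}"
      unfolding nbrs[OF i'(1)] gray_i
    proof (rule argmax_set_image_eq[where x = k and f = "\<lambda>k. stretch d (vertex (flip k (gray i)))"])
      fix j assume j: "j \<in> {k\<in>{..<CARD('n)}. \<not> bit i k}" "j \<noteq> k"
      then have "k < j" using bits by (metis (mono_tags, lifting) linorder_neqE_nat mem_Collect_eq)
      then show "c \<bullet> (stretch d (vertex (flip j (gray i))) - stretch d (vertex (gray i)))
          / \<eta> (stretch d (vertex (flip j (gray i))) - stretch d (vertex (gray i)))
        < c \<bullet> (stretch d (vertex (flip k (gray i))) - stretch d (vertex (gray i)))
          / \<eta> (stretch d (vertex (flip k (gray i))) - stretch d (vertex (gray i)))"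
        unfolding diff c using order gray_subset[OF i'(1)] j k up_gray[OF i'(1)] by simp
    qed (use k in simp)
  qed
qed

text \<open>The last Gray code word is \<open>{m}\<close> with \<open>m = CARD('n) - 1\<close>,
  whose objective value meets the bound of \<open>psum_le\<close>.\<close>

lemma inner_le_last_vertex:
  assumes "x \<in> deformed_cube"
  shows "1 \<bullet> x \<le> 1 \<bullet> vertex (gray (2 ^ CARD('n) - 1))"
proof -
  obtain \<theta> where \<theta>: "inbox CARD('n) \<theta>" "x = deform \<theta>" by (rule deform_surj[OF assms])
  obtain m where m: "CARD('n) = Suc m"
    using zero_less_card_finite[where 'a='n] by (metis not0_implies_Suc less_irrefl)
  have "1 \<bullet> x = psum \<theta> CARD('n)"
    unfolding inner_vec_def sum_index by (simp add: sum_deform \<theta>(2))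
  also have "\<dots> \<le> 3 ^ m"
    using \<theta>(1) unfolding m inbox_def by (intro psum_le) auto
  also have "\<dots> = 1 \<bullet> vertex (gray (2 ^ CARD('n) - 1))"
    unfolding inner_one_vertex m gray_last psum_bits_last ..
  finally show ?thesis .
qed

end

theorem theorem1p3:
  fixes \<eta> :: "real ^ 'n \<Rightarrow> real"
  assumes "is_norm \<eta>"
  shows "\<exists>(C :: (real ^ 'n) set) (c :: real ^ 'n).
           combinatorial_cube C \<and>
           (\<exists>v N. pivot_run \<eta> C c v N \<and>
                  v ` {..N} = vertices C \<and>
                  (\<forall>x\<in>C. c \<bullet> x \<le> c \<bullet> v N))"
proof -
  obtain e :: "nat \<Rightarrow> 'n" where "bij_betw e {..<CARD('n)} UNIV"
    using ex_bij_betw_nat_finite[of "UNIV :: 'n set"] by (auto simp: atLeast0LessThan)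
  then interpret coordinate_enumeration e by unfold_locales
  \<comment> \<open>Only finitely many comparisons are involved, so one small \<open>d\<close>
    serves all vertices at once.\<close>
  obtain d where d: "0 < d" and order: "\<forall>b\<in>Pow {..<CARD('n)}. \<forall>k\<in>{..<CARD('n)}. \<forall>l\<in>{..<CARD('n)}.
      k < l \<and> up CARD('n) b k \<and> up CARD('n) b l \<longrightarrow>
      1 \<bullet> edge b l / \<eta> (stretch d (edge b l)) < 1 \<bullet> edge b k / \<eta> (stretch d (edge b k))"
    using eventually_happens'[OF trivial_limit_at_right_real
        eventually_conj[OF eventually_at_right_less eventually_stretch_order[OF assms]]] by blast
  note f = linear_stretch[of d] inj_stretch[OF d]
  obtain g where g: "linear g" "g \<circ> stretch d = id"
    using linear_injective_left_inverse[OF f] by blast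
  \<comment> \<open>The adjoint of a left inverse of \<open>stretch d\<close> carries the
    coordinate-sum objective over to the stretched cube.\<close>
  define c where "c = adjoint g 1"
  have c: "c \<bullet> stretch d x = 1 \<bullet> x" for x
    using adjoint_clauses(2)[OF g(1), of 1 "stretch d x"] g(2) by (simp add: c_def pointfree_idE)
  let ?C = "stretch d ` deformed_cube" and ?N = "2 ^ CARD('n) - 1 :: nat"
  have "combinatorial_cube ?C"
    unfolding combinatorial_cube_def
    using polytope_linear_image[OF f(1) polytope_deformed_cube]
      aff_dim_injective_linear_image[OF f] aff_dim_deformed_cube
      face_lattice_isomorphic_sym[OF face_lattice_isomorphic_linear_image[OF f deformed_cube_isomorphic]]
    by simp
  moreover have "pivot_run \<eta> ?C c (\<lambda>i. stretch d (vertex (gray i))) ?N"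
    by (rule pivot_run_stretch[OF d order c])
  moreover have "(\<lambda>i. stretch d (vertex (gray i))) ` {..?N} = vertices ?C"
  proof -
    have "{..?N} = {..<2 ^ CARD('n)}" by (simp flip: lessThan_Suc_atMost)
    then have "(\<lambda>i. stretch d (vertex (gray i))) ` {..?N} = stretch d ` vertex ` gray ` {..<2 ^ CARD('n)}"
      by (simp add: image_image)
    then show ?thesis
      by (simp add: gray_image vertices_linear_image[OF f] vertices_deformed_cube)
  qed
  moreover have "\<forall>x\<in>?C. c \<bullet> x \<le> c \<bullet> stretch d (vertex (gray ?N))"
    using inner_le_last_vertex by (auto simp: c)
  ultimately show ?thesis by blast
qed

end
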